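(* Let $m\ge 3$ and $n\ge 1$ be integers and let $T$ be a real cubic tensor with $m$ modes and dimension $n$ (not necessarily symmetric), with entries $T_{i_1,\dots,i_m}$, $1\le i_1,\dots,i_m\le n$. Let $\Lambda$ be a prescribed map sending a real $n\times n$ matrix $M$ (in the domain of $\Lambda$) to one of its real eigenvectors $\Lambda(M)\in\mathbb{R}^n$, normalized so that $\|\Lambda(M)\|_2=1$. Consider the dynamical system $$\frac{dx}{dt}=\Lambda\big(T[x]^{m-2}\big)-x .$$ If this dynamical system converges to a non-zero solution $x^*\in\mathbb{R}^n$, then $x^*$ is a tensor $Z$-eigenvector of $T$, i.e. $\|x^*\|_2=1$ and there is $\lambda\in\mathbb{R}$ such that $T(x^* )^{m-1}=\lambda x^*$.
   Context: A cubic tensor with $m$ modes and dimension $n$ is an $n\times\cdots\times n$ ($m$ times) array of real numbers $T_{i_1,\dots,i_m}$. Tensor apply: for $x\in\mathbb{R}^n$, $T x^{m-1}\in\mathbb{R}^n$ is the vector with entries $(Tx^{m-1})_{i_1}=\sum_{i_2,\dots,i_m} T_{i_1,i_2,\dots,i_m}x_{i_2}\cdots x_{i_m}$. Tensor collapse: for $x\in\mathbb{R}^n$, $T[x]^{m-2}$ is the $n\times n$ matrix with entries $(T[x]^{m-2})_{ij}=\sum_{i_3,\dots,i_m}T_{i,j,i_3,\dots,i_m}x_{i_3}\cdots x_{i_m}$. $Z$-eigenvector: a vector $x\in\mathbb{R}^n$ with $\|x\|_2=1$ and $Tx^{m-1}=\lambda x$ for some scalar $\lambda$ (the $Z$-eigenvalue).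 The map $\Lambda$ is a fixed map that takes a matrix and outputs a prescribed unit-norm eigenvector of it (for example, the eigenvector for the $k$th largest algebraic or magnitude eigenvalue, or the eigenvector closest to a given vector, with a fixed sign convention). It may be defined only on some matrices, and it is not assumed continuous. Convergence convention: "the dynamical system converges to $x^*$" means that a trajectory $x(t)$ tends to $x^*$ as $t\to\infty$ and that $x^*$ is a stationary point of the system, i.e. $T[x^*]^{m-2}$ is in the domain of $\Lambda$ and the right-hand side $\Lambda(T[x^*]^{m-2})-x^*$ vanishes. *)

theory Defs
  imports "HOL-Analysis.Analysis"
begin

text \<open>
  A cubic tensor with \<open>m\<close> modes over the index type \<open>'n\<close> is a family of reals indexed by lists
  of length \<open>m\<close>; the values on lists of any other length are irrelevant and never used.
\<close>

type_synonym 'n tensor = "'n list \<Rightarrow> real"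

definition tensor_apply :: "nat \<Rightarrow> 'n::finite tensor \<Rightarrow> real ^ 'n \<Rightarrow> real ^ 'n" where
  "tensor_apply m T x =
     (\<chi> i. \<Sum>js | length js = m - 1. T (i # js) * (\<Prod>j\<leftarrow>js. x $ j))"

definition tensor_collapse :: "nat \<Rightarrow> 'n::finite tensor \<Rightarrow> real ^ 'n \<Rightarrow> real ^ 'n ^ 'n" where
  "tensor_collapse m T x =
     (\<chi> i j. \<Sum>js | length js = m - 2. T (i # j # js) * (\<Prod>k\<leftarrow>js. x $ k))"

definition Z_eigenvector :: "nat \<Rightarrow> 'n::finite tensor \<Rightarrow> real ^ 'n \<Rightarrow> bool" where
  "Z_eigenvector m T x \<longleftrightarrow> norm x = 1 \<and> (\<exists>c. tensor_apply m T x = c *\<^sub>R x)"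

definition matrix_eigenvector :: "real ^ 'n ^ 'n \<Rightarrow> real ^ 'n \<Rightarrow> bool" where
  "matrix_eigenvector M v \<longleftrightarrow> v \<noteq> 0 \<and> (\<exists>c. M *v v = c *\<^sub>R v)"

text \<open>
  The prescribed map is partial: \<open>dom \<Lambda>\<close> is the set of matrices on which it is defined.
\<close>

definition eigenvector_map :: "(real ^ 'n ^ 'n \<rightharpoonup> real ^ 'n) \<Rightarrow> bool" where
  "eigenvector_map \<Lambda> \<longleftrightarrow>
     (\<forall>M\<in>dom \<Lambda>. matrix_eigenvector M (the (\<Lambda> M)) \<and> norm (the (\<Lambda> M)) = 1)"

text \<open>
  The right-hand side of the system; meaningful only where the collapsed tensor lies in \<open>dom \<Lambda>\<close>.
\<close>

definition rhs ::
  "nat \<Rightarrow> 'n::finite tensor \<Rightarrow> (real ^ 'n ^ 'n \<rightharpoonup> real ^ 'n) \<Rightarrow> real ^ 'n \<Rightarrow> real ^ 'n" where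
  "rhs m T \<Lambda> x = the (\<Lambda> (tensor_collapse m T x)) - x"

definition trajectory ::
  "nat \<Rightarrow> 'n::finite tensor \<Rightarrow> (real ^ 'n ^ 'n \<rightharpoonup> real ^ 'n) \<Rightarrow> (real \<Rightarrow> real ^ 'n) \<Rightarrow> bool" where
  "trajectory m T \<Lambda> x \<longleftrightarrow>
     (\<forall>t\<ge>0. tensor_collapse m T (x t) \<in> dom \<Lambda> \<and>
            (x has_vector_derivative rhs m T \<Lambda> (x t)) (at t within {0..}))"

definition stationary_point ::
  "nat \<Rightarrow> 'n::finite tensor \<Rightarrow> (real ^ 'n ^ 'n \<rightharpoonup> real ^ 'n) \<Rightarrow> real ^ 'n \<Rightarrow> bool" where
  "stationary_point m T \<Lambda> x \<longleftrightarrow> tensor_collapse m T x \<in> dom \<Lambda> \<and> rhs m T \<Lambda> x = 0"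

text \<open>
  Since \<open>\<Lambda>\<close> need not be continuous, the limit of a trajectory need not be stationary,
  so stationarity is part of the notion of convergence of the system.
\<close>

definition system_converges_to ::
  "nat \<Rightarrow> 'n::finite tensor \<Rightarrow> (real ^ 'n ^ 'n \<rightharpoonup> real ^ 'n) \<Rightarrow> real ^ 'n \<Rightarrow> bool" where
  "system_converges_to m T \<Lambda> x' \<longleftrightarrow>
     (\<exists>x. trajectory m T \<Lambda> x \<and> (x \<longlongrightarrow> x') at_top) \<and> stationary_point m T \<Lambda> x'"

end

theory Submission
  imports Defs
begin

text \<open>At a stationary point \<open>x'\<close> is the value of \<open>\<Lambda>\<close> at its
  own collapsed matrix, hence a unit eigenvector of that matrix. Multiplying the matrix by
  \<open>x'\<close> contracts one more mode and yields \<open>tensor_apply m T x'\<close>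
  (\<open>tensor_collapse_mult_vec\<close>), so the matrix eigenvalue equation is the tensor one,
  with the same eigenvalue.\<close>

lemma sum_lists_length_Suc:
  fixes f :: "'a::finite list \<Rightarrow> 'b::comm_monoid_add"
  shows "(\<Sum>xs | length xs = Suc k. f xs) = (\<Sum>x\<in>UNIV. \<Sum>xs | length xs = k. f (x # xs))"
proof -
  have "{xs :: 'a list. length xs = Suc k} = (\<lambda>(x, xs). x # xs) ` (UNIV \<times> {xs. length xs = k})"
    by (auto simp: length_Suc_conv image_iff)
  moreover have "inj_on (\<lambda>(x :: 'a, xs). x # xs) (UNIV \<times> {xs. length xs = k})"
    by (auto intro: inj_onI)
  ultimately show ?thesis
    by (simp add: sum.reindex sum.cartesian_product case_prod_unfold)
qed

text \<open>The column index \<open>j\<close> of the matrix product, put in front of an index list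
  of length \<open>m - 2\<close>, runs over all lists of length \<open>m - 1\<close>; its factor
  \<open>x $ j\<close> joins the product.\<close>

lemma tensor_collapse_mult_vec:
  assumes "m \<ge> 2"
  shows "tensor_collapse m T x *v x = tensor_apply m T x"
proof -
  \<comment> \<open>Subtraction is truncated, so this needs \<open>m \<ge> 2\<close>; it exposes the
    \<open>Suc\<close> at which \<open>sum_lists_length_Suc\<close> splits.\<close>
  have "m - 1 = Suc (m - 2)"
    using assms by simp
  then show ?thesis
    by (simp add: vec_eq_iff tensor_collapse_def tensor_apply_def matrix_vector_mult_def
        sum_lists_length_Suc sum_distrib_left mult_ac)
qed

theorem proposition2p1:
  fixes m :: nat
    and T :: "'n::finite tensor"
    and \<Lambda> :: "real ^ 'n ^ 'n \<rightharpoonup> real ^ 'n"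
    and x' :: "real ^ 'n"
  assumes "m \<ge> 3"
    and "eigenvector_map \<Lambda>"
    and "system_converges_to m T \<Lambda> x'"
    and "x' \<noteq> 0"
  shows "Z_eigenvector m T x'"
proof -
  let ?M = "tensor_collapse m T x'"
  \<comment> \<open>The vanishing right-hand side is read as a fixed-point equation.\<close>
  have "?M \<in> dom \<Lambda>" and "the (\<Lambda> ?M) = x'"
    using assms(3) by (simp_all add: system_converges_to_def stationary_point_def rhs_def)
  then have "matrix_eigenvector ?M x'" and "norm x' = 1"
    using assms(2) unfolding eigenvector_map_def by metis+
  then show ?thesis
    using assms(1) by (simp add: Z_eigenvector_def matrix_eigenvector_def tensor_collapse_mult_vec)
qed

end
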